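(* For every ordered graph $G$ there is a constant $c$ (depending on $G$) such that for all integers $n\ge 1$, \[ r_o(G,C_n)\le r_o(G,P_m)+c,\qquad\text{where } m=(n-1)(|V(G)|-1)+1 . \]
   Context: An ordered graph is a graph with a linear ordering on its vertices; subgraphs inherit the ordering, and copies are taken via order-preserving isomorphisms. The ordered path $P_n$ has vertices $v_1<\dots<v_n$ and edges $v_iv_{i+1}$; the ordered cycle $C_n$ is obtained from $P_n$ by adding the edge $v_1v_n$. The online ordered Ramsey game for ordered graphs $G,H$ is played on vertex set $\mathbb N$ with its usual order: on each turn Builder draws a new edge between two vertices and Painter colors it red or blue; the game ends when there is a red copy of $G$ or a blue copy of $H$. Builder minimizes and Painter maximizes the number of turns; $r_o(G,H)$ is the number of turns under optimal play. *)

theory Defs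
  imports Main "HOL-Library.Extended_Nat"
begin

text \<open>The linear ordering of the vertices is the one of the vertex type; edges are two-element sets.\<close>

record 'a ograph =
  verts :: "'a set"
  edges :: "'a set set"

definition ordered_graph :: "'a::linorder ograph \<Rightarrow> bool" where
  "ordered_graph G \<longleftrightarrow> finite (verts G) \<and> (\<forall>e\<in>edges G. e \<subseteq> verts G \<and> card e = 2)"

definition subgraph :: "'a ograph \<Rightarrow> 'a ograph \<Rightarrow> bool" where
  "subgraph H F \<longleftrightarrow> verts H \<subseteq> verts F \<and> edges H \<subseteq> edges F \<and> (\<forall>e\<in>edges H. e \<subseteq> verts H)"

definition order_iso :: "('a::linorder \<Rightarrow> 'b::linorder) \<Rightarrow> 'a ograph \<Rightarrow> 'b ograph \<Rightarrow> bool" where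
  "order_iso f G H \<longleftrightarrow>
     strict_mono_on (verts G) f \<and> f ` verts G = verts H \<and> (\<lambda>e. f ` e) ` edges G = edges H"

definition has_copy :: "'a::linorder ograph \<Rightarrow> 'b::linorder ograph \<Rightarrow> bool" where
  "has_copy G F \<longleftrightarrow> (\<exists>H f. subgraph H F \<and> order_iso f G H)"

definition ordered_path :: "nat \<Rightarrow> nat ograph" where
  "ordered_path n = \<lparr>verts = {1..n}, edges = {{i, i + 1} | i. 1 \<le> i \<and> i < n}\<rparr>"

text \<open>Graphs are simple: for \<open>n = 1\<close> the added edge would be a loop, so the one-vertex cycle
  is a single vertex; for \<open>n = 2\<close> the added edge is already present.\<close>

definition ordered_cycle :: "nat \<Rightarrow> nat ograph" where
  "ordered_cycle n =
     \<lparr>verts = {1..n}, edges = edges (ordered_path n) \<union> (if n \<ge> 2 then {{1, n}} else {})\<rparr>"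

text \<open>A position of the game is given by the sets \<open>R\<close> and \<open>B\<close> of red and blue edges drawn so far
  on the vertex set of all natural numbers.\<close>

definition game_over ::
  "'a::linorder ograph \<Rightarrow> 'b::linorder ograph \<Rightarrow> nat set set \<Rightarrow> nat set set \<Rightarrow> bool" where
  "game_over G H R B \<longleftrightarrow>
     has_copy G \<lparr>verts = UNIV, edges = R\<rparr> \<or> has_copy H \<lparr>verts = UNIV, edges = B\<rparr>"

text \<open>Builder can force the game to end within \<open>k\<close> further turns, whatever Painter does.\<close>

primrec builder_forces ::
  "'a::linorder ograph \<Rightarrow> 'b::linorder ograph \<Rightarrow> nat \<Rightarrow> nat set set \<Rightarrow> nat set set \<Rightarrow> bool" where
  "builder_forces G H 0 R B \<longleftrightarrow> game_over G H R B"
| "builder_forces G H (Suc k) R B \<longleftrightarrow> game_over G H R B \<or>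
     (\<exists>e. card e = 2 \<and> e \<notin> R \<union> B \<and>
        builder_forces G H k (insert e R) B \<and> builder_forces G H k R (insert e B))"

text \<open>The number of turns under optimal play; it would be \<open>\<infinity>\<close> if Builder could not
  force the end of the game within any fixed number of turns.\<close>

definition r_o :: "'a::linorder ograph \<Rightarrow> 'b::linorder ograph \<Rightarrow> enat" where
  "r_o G H = Inf {enat k | k. builder_forces G H k {} {}}"

end

theory Submission
  imports Defs "HOL-Library.Ramsey"
begin

text \<open>Let \<open>N = |V(G)|\<close> and \<open>h = n - 1\<close>. Small \<open>n\<close> are covered by Ramsey's theorem. For large \<open>n\<close>, Builder
  first plays for \<open>P\<^sub>m\<close>, obtaining a blue path with positions \<open>0, \<dots>, (N - 1)h\<close>, and then draws all edges
  inside a set \<open>S\<close> of positions whose size depends only on \<open>N\<close>. If no \<open>N\<close> positions of \<open>S\<close> span a red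
  clique, then two of the positions \<open>0, h, 2h, \<dots>\<close> are joined by a blue edge, say at distance \<open>d h\<close>,
  and it remains to find an increasing blue path of length exactly \<open>h\<close> between them.

  Blue edges serve as shortcuts at three scales. On a grid of step \<open>g\<close> proportional to \<open>h\<close>, the
  absence of red \<open>N\<close>-cliques bounds the number of grid steps needed to reach the end by \<open>N - 1\<close>
  (plus boundedly many jumps), so a path that goes straight to roughly position \<open>h\<close> and then crosses
  this way has length \<open>h + (a + 1) g + O(1)\<close> with \<open>a < N\<close>. The first \<open>h\<close> positions are still
  available for shortcuts: equal jumps along a finer grid of step \<open>t\<close>, where \<open>g = Z t\<close> and \<open>Z\<close> is divisible by
  all possible jump lengths, remove \<open>(a + 1) g\<close> up to a bounded error, and jumps in a segment of bounded
  length remove the bounded rest exactly.\<close>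

section \<open>Copies and forcing\<close>

lemma has_copyI:
  assumes "strict_mono_on (verts G) f" and "\<forall>e\<in>edges G. e \<subseteq> verts G \<and> f ` e \<in> E"
  shows "has_copy G \<lparr>verts = UNIV, edges = E\<rparr>"
  unfolding has_copy_def
  by (intro exI[of _ "\<lparr>verts = f ` verts G, edges = (\<lambda>e. f ` e) ` edges G\<rparr>"] exI[of _ f])
    (use assms in \<open>auto simp: subgraph_def order_iso_def\<close>)

text \<open>Matching vertices by rank preserves the order, and a clique contains the image of every
  edge.\<close>

lemma has_copy_clique:
  fixes G :: "'a::linorder ograph" and A :: "'b::wellorder set"
  assumes G: "ordered_graph G" and A: "finite A" "card A = card (verts G)" "clique A E"
  shows "has_copy G \<lparr>verts = UNIV, edges = E\<rparr>"
proof -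
  obtain h where h: "bij_betw h {..<card A} A" "strict_mono_on {..<card A} h"
    using ex_bij_betw_strict_mono_card[OF A(1)] by blast
  let ?V = "verts G"
  define rank where "rank u = card {w\<in>?V. w < u}" for u
  have fin: "finite ?V" using G by (simp add: ordered_graph_def)
  have rank_less: "rank u < card A" if "u \<in> ?V" for u
    unfolding rank_def A(2) by (rule psubset_card_mono) (use that fin in auto)
  have rank_mono: "rank u < rank v" if "u \<in> ?V" "v \<in> ?V" "u < v" for u v
    unfolding rank_def by (rule psubset_card_mono) (use that fin in auto)
  define f where "f = h \<circ> rank"
  have f_mono: "strict_mono_on ?V f"
    using h(2) rank_less rank_mono by (auto simp: strict_mono_on_def f_def)
  have f_mem: "f u \<in> A" if "u \<in> ?V" for u
    using h(1) rank_less[OF that] by (auto simp: f_def bij_betw_def)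
  show ?thesis
  proof (rule has_copyI[OF f_mono], intro ballI conjI)
    fix e assume e: "e \<in> edges G"
    then show "e \<subseteq> ?V" using G by (auto simp: ordered_graph_def)
    from e obtain u v where uv: "e = {u, v}" "u \<noteq> v" "u \<in> ?V" "v \<in> ?V"
      using G by (auto simp: ordered_graph_def card_2_iff)
    then have "f u \<noteq> f v" using f_mono by (metis strict_mono_on_eqD)
    then show "f ` e \<in> E" using uv f_mem A(3) by (auto simp: clique_def)
  qed
qed

section \<open>Composition of Builder's strategies\<close>

lemma game_over_imp_builder_forces: "game_over G H R B \<Longrightarrow> builder_forces G H k R B"
  by (cases k) auto

lemma builder_forces_mono:
  "builder_forces G H k R B \<Longrightarrow> k \<le> l \<Longrightarrow> builder_forces G H l R B"
proof (induction k arbitrary: l R B)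
  case 0
  then show ?case by (simp add: game_over_imp_builder_forces)
next
  case (Suc k)
  then obtain l' where "l = Suc l'" by (cases l) auto
  with Suc show ?case by auto
qed

text \<open>Builder follows the strategy for \<open>H\<close> until that game ends and then has
  \<open>c\<close> turns from the position reached; turns left over by an early end do no
  harm.\<close>

lemma builder_forces_trans:
  assumes "builder_forces G H k R B"
    and "\<And>R B. game_over G H R B \<Longrightarrow> builder_forces G H' c R B"
  shows "builder_forces G H' (k + c) R B"
  using assms(1)
proof (induction k arbitrary: R B)
  case 0
  then show ?case using assms(2) by simp
next
  case (Suc k)
  then consider "game_over G H R B"
    | e where "card e = 2" "e \<notin> R \<union> B" "builder_forces G H k (insert e R) B"
      "builder_forces G H k R (insert e B)" by auto
  then show ?case
  proof cases
    case 1
    then show ?thesis using assms(2) builder_forces_mono le_add2 by blast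
  next
    case 2
    then show ?thesis using Suc.IH by auto
  qed
qed

text \<open>Builder draws the edges of \<open>F\<close> whatever the answers are. Edges that are
  already coloured are skipped, so \<open>card F\<close> is only an upper bound.\<close>

lemma builder_forces_query:
  assumes "finite F" and "\<forall>e\<in>F. card e = 2"
    and "\<And>R' B'. R \<subseteq> R' \<Longrightarrow> B \<subseteq> B' \<Longrightarrow> F \<subseteq> R' \<union> B' \<Longrightarrow> game_over G H R' B'"
  shows "builder_forces G H (card F) R B"
  using assms
proof (induction F arbitrary: R B rule: finite_induct)
  case empty
  then show ?case by simp
next
  case (insert e F)
  show ?case
  proof (cases "e \<in> R \<union> B")
    case True
    have "builder_forces G H (card F) R B"
    proof (rule insert.IH)
      fix R' B' assume "R \<subseteq> R'" "B \<subseteq> B'" "F \<subseteq> R' \<union> B'"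
      then show "game_over G H R' B'" using True by (intro insert.prems(2)) auto
    qed (use insert.prems in auto)
    moreover have "card F \<le> card (insert e F)" using insert.hyps by simp
    ultimately show ?thesis by (rule builder_forces_mono)
  next
    case False
    have "builder_forces G H (card F) (insert e R) B" "builder_forces G H (card F) R (insert e B)"
      by (rule insert.IH; use insert.prems in auto)+
    moreover have "card e = 2" using insert.prems by simp
    ultimately have "builder_forces G H (Suc (card F)) R B" using False by auto
    then show ?thesis using insert.hyps by simp
  qed
qed

section \<open>The value of the game and its finiteness\<close>

lemma r_o_le: "builder_forces G H k {} {} \<Longrightarrow> r_o G H \<le> enat k"
  unfolding r_o_def by (rule Inf_lower) auto

lemma r_o_enat_imp_builder_forces:
  assumes "r_o G H = enat k"
  shows "builder_forces G H k {} {}"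
proof -
  let ?X = "{enat k | k. builder_forces G H k {} {}}"
  have "?X \<noteq> {}"
  proof
    assume "?X = {}"
    then show False using assms by (simp add: r_o_def Inf_enat_def)
  qed
  then have "Inf ?X \<in> ?X" by (rule wellorder_InfI[OF some_in_eq[THEN iffD2]])
  then show ?thesis using assms by (auto simp: r_o_def)
qed

definition pairs :: "'a set \<Rightarrow> 'a set set" where
  "pairs S = {e. e \<subseteq> S \<and> card e = 2}"

lemma finite_pairs: "finite S \<Longrightarrow> finite (pairs S)"
  by (simp add: pairs_def)

lemma card_pairs: "finite S \<Longrightarrow> card (pairs S) = card S choose 2"
  by (simp add: pairs_def n_subsets)

lemma ordered_graph_cycle: "ordered_graph (ordered_cycle n)"
  by (auto simp: ordered_graph_def ordered_cycle_def ordered_path_def card_insert_if)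

text \<open>Builder draws all edges on a Ramsey number of vertices: a red clique contains
  \<open>G\<close>, and a set without red edges is a blue clique and contains
  \<open>H\<close>.\<close>

lemma builder_forces_ramsey:
  fixes G :: "'a::linorder ograph" and H :: "'b::linorder ograph"
  assumes "ordered_graph G" "ordered_graph H"
  shows "\<exists>k. builder_forces G H k {} {}"
proof -
  obtain r :: nat where r: "\<forall>(V::nat set) E. finite V \<and> card V \<ge> r \<longrightarrow>
    (\<exists>A \<subseteq> V. card A = card (verts G) \<and> clique A E \<or> card A = card (verts H) \<and> indep A E)"
    using ramsey2[of "card (verts G)" "card (verts H)"] by blast
  have "builder_forces G H (card (pairs {..<r})) {} {}"
  proof (rule builder_forces_query)
    fix R B :: "nat set set" assume RB: "pairs {..<r} \<subseteq> R \<union> B"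
    obtain A where A: "A \<subseteq> {..<r}"
      "card A = card (verts G) \<and> clique A R \<or> card A = card (verts H) \<and> indep A R"
      using r by (metis card_lessThan finite_lessThan le_refl)
    then have finA: "finite A" using finite_subset by blast
    from A(2) show "game_over G H R B"
    proof
      assume "card A = card (verts G) \<and> clique A R"
      then have "has_copy G \<lparr>verts = UNIV, edges = R\<rparr>"
        by (intro has_copy_clique[OF assms(1) finA]) auto
      then show ?thesis by (simp add: game_over_def)
    next
      assume *: "card A = card (verts H) \<and> indep A R"
      then have "clique A B"
        unfolding clique_def
      proof (intro ballI impI)
        fix v w assume vw: "v \<in> A" "w \<in> A" "v \<noteq> w"
        then have "{v, w} \<in> pairs {..<r}" using A(1) by (auto simp: pairs_def)
        then show "{v, w} \<in> B" using vw * RB by (auto simp: indep_def)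
      qed
      then have "has_copy H \<lparr>verts = UNIV, edges = B\<rparr>"
        using * by (intro has_copy_clique[OF assms(2) finA]) auto
      then show ?thesis by (simp add: game_over_def)
    qed
  qed (auto simp: finite_pairs, auto simp: pairs_def)
  then show ?thesis by blast
qed

section \<open>Shortcuts along an increasing path\<close>

text \<open>\<open>s\<close> is the saving against the walk by unit steps. Savings add up over
  consecutive segments and vanish on segments walked straight.\<close>

definition saves :: "nat rel \<Rightarrow> nat \<Rightarrow> nat \<Rightarrow> nat \<Rightarrow> bool" where
  "saves r s x y \<longleftrightarrow> (\<exists>l. (x, y) \<in> r ^^ l \<and> x + l + s = y)"

text \<open>With \<open>r\<close> the increasing blue pairs and all pairs inside \<open>X\<close>
  coloured, this excludes red cliques on \<open>N\<close> positions of \<open>X\<close>.\<close>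

definition hits :: "nat rel \<Rightarrow> nat \<Rightarrow> nat set \<Rightarrow> bool" where
  "hits r N X \<longleftrightarrow> (\<forall>A\<subseteq>X. card A = N \<longrightarrow> (\<exists>a\<in>A. \<exists>b\<in>A. a < b \<and> (a, b) \<in> r))"

definition base :: "nat rel \<Rightarrow> nat \<Rightarrow> nat \<Rightarrow> bool" where
  "base r x y \<longleftrightarrow> (\<forall>i. x \<le> i \<and> i < y \<longrightarrow> (i, Suc i) \<in> r)"

lemma hits_mono: "hits r N Y \<Longrightarrow> X \<subseteq> Y \<Longrightarrow> hits r N X"
  by (auto simp: hits_def)

lemma base_mono: "base r x y \<Longrightarrow> x \<le> x' \<Longrightarrow> y' \<le> y \<Longrightarrow> base r x' y'"
  by (auto simp: base_def)

lemma base_relpow: "base r x (x + l) \<Longrightarrow> (x, x + l) \<in> r ^^ l"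
proof (induction l)
  case (Suc l)
  then have "(x, x + l) \<in> r ^^ l" using base_mono by fastforce
  moreover have "(x + l, x + Suc l) \<in> r" using Suc.prems by (auto simp: base_def)
  ultimately show ?case by auto
qed simp

lemma relpow_trans: "(x, y) \<in> r ^^ k \<Longrightarrow> (y, z) \<in> r ^^ l \<Longrightarrow> (x, z) \<in> r ^^ (k + l)"
  by (auto simp: relpow_add)

lemma saves_trans: "saves r s x y \<Longrightarrow> saves r s' y z \<Longrightarrow> saves r (s + s') x z"
proof -
  assume "saves r s x y" "saves r s' y z"
  then obtain l l' where "(x, y) \<in> r ^^ l" "x + l + s = y" "(y, z) \<in> r ^^ l'" "y + l' + s' = z"
    by (auto simp: saves_def)
  then show ?thesis unfolding saves_def by (intro exI[of _ "l + l'"] conjI relpow_trans) auto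
qed

lemma saves_base: "base r x y \<Longrightarrow> x \<le> y \<Longrightarrow> saves r 0 x y"
  unfolding saves_def using base_relpow[of r x "y - x"] by auto

lemma saves_jump:
  assumes "base r x z" "x \<le> y" "y < y'" "y' \<le> z" "(y, y') \<in> r"
  shows "saves r (y' - y - 1) x z"
proof -
  have "saves r 0 x y" "saves r 0 y' z"
    using assms by (auto intro!: saves_base base_mono[OF assms(1)])
  moreover have "saves r (y' - y - 1) y y'"
    unfolding saves_def using assms by (intro exI[of _ 1]) auto
  ultimately show ?thesis using saves_trans[of r 0 x y] saves_trans[of r _ x y' 0 z] by fastforce
qed

lemma saves_sum:
  "(\<And>b. b < L \<Longrightarrow> saves r (f b) (x + b * D) (x + Suc b * D)) \<Longrightarrow>
    saves r (\<Sum>b<L. f b) x (x + L * D)"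
proof (induction L)
  case 0
  show ?case by (simp add: saves_def)
next
  case (Suc L)
  then have "saves r (\<Sum>b<L. f b) x (x + L * D)" by simp
  moreover have "saves r (f L) (x + L * D) (x + Suc L * D)" using Suc by blast
  ultimately show ?case using saves_trans by (simp only: sum.lessThan_Suc)
qed

text \<open>The first \<open>N\<close> grid points contain a joined pair. Its distance
  \<open>j\<close> in grid steps is up to Painter, but takes fewer than \<open>N\<close>
  values.\<close>

lemma saves_block:
  assumes "t > 0" "base r x (x + N * t)" "hits r N X" "\<And>i. i \<le> N \<Longrightarrow> x + i * t \<in> X"
  shows "\<exists>j\<in>{1..<N}. saves r (j * t - 1) x (x + N * t)"
proof -
  let ?A = "(\<lambda>i. x + i * t) ` {..<N}"
  have "card ?A = N" using assms(1) by (subst card_image) (auto simp: inj_on_def)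
  moreover have "?A \<subseteq> X" using assms(4) by auto
  ultimately have "\<exists>a\<in>?A. \<exists>b\<in>?A. a < b \<and> (a, b) \<in> r"
    using assms(3) unfolding hits_def by blast
  then obtain i i' where i: "i < N" "i' < N" "x + i * t < x + i' * t" "(x + i * t, x + i' * t) \<in> r"
    by blast
  then have "i < i'" by auto
  have "saves r ((x + i' * t) - (x + i * t) - 1) x (x + N * t)"
    using i by (intro saves_jump[OF assms(2)]) auto
  also have "(x + i' * t) - (x + i * t) - 1 = (i' - i) * t - 1"
    by (simp add: diff_mult_distrib)
  finally show ?thesis using \<open>i < i'\<close> i by (intro bexI[of _ "i' - i"]) auto
qed

text \<open>By pigeonhole, \<open>q\<close> of the \<open>N * q\<close> blocks offer the same
  \<open>j\<close>; jumping in any \<open>k\<close> of these and walking straight elsewhere saves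
  \<open>k\<close> times the same amount.\<close>

lemma saves_many_blocks:
  assumes "t > 0" "N \<ge> 2" "L = N * q" and bs: "base r x (x + L * (N * t))"
    and X: "hits r N X" "\<And>i. i \<le> L * N \<Longrightarrow> x + i * t \<in> X"
  shows "\<exists>j\<in>{1..<N}. \<forall>k\<le>q. saves r (k * (j * t - 1)) x (x + L * (N * t))"
proof -
  have "\<exists>j\<in>{1..<N}. saves r (j * t - 1) (x + b * (N * t)) (x + Suc b * (N * t))" if "b < L" for b
  proof -
    have bL: "Suc b * N \<le> L * N" using that by (intro mult_le_mono1) simp
    have le: "Suc b * (N * t) \<le> L * (N * t)" using that by (intro mult_le_mono1) simp
    have "\<exists>j\<in>{1..<N}. saves r (j * t - 1) (x + b * (N * t)) (x + b * (N * t) + N * t)"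
    proof (rule saves_block[OF assms(1) _ X(1)])
      show "base r (x + b * (N * t)) (x + b * (N * t) + N * t)"
        by (rule base_mono[OF bs]) (use le in auto)
      fix i assume "i \<le> N"
      then have "x + (b * N + i) * t \<in> X" using bL by (intro X(2)) auto
      then show "x + b * (N * t) + i * t \<in> X" by (simp add: algebra_simps)
    qed
    then show ?thesis by (simp add: algebra_simps)
  qed
  then obtain J where J: "\<And>b. b < L \<Longrightarrow> J b \<in> {1..<N}"
    "\<And>b. b < L \<Longrightarrow> saves r (J b * t - 1) (x + b * (N * t)) (x + Suc b * (N * t))"
    by metis
  have "\<exists>j\<in>{1..<N}. card (J -` {j} \<inter> {..<L}) * card {1..<N} \<ge> card {..<L}"
    by (rule pigeonhole_card) (use J assms in auto)
  then obtain j where j: "j \<in> {1..<N}" "card (J -` {j} \<inter> {..<L}) * (N - 1) \<ge> L" by auto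
  have q: "q \<le> card (J -` {j} \<inter> {..<L})"
  proof (rule ccontr)
    assume *: "\<not> ?thesis"
    then have "card (J -` {j} \<inter> {..<L}) * (N - 1) \<le> card (J -` {j} \<inter> {..<L}) * N" by simp
    also have "\<dots> < q * N" using * assms by auto
    finally show False using j assms(3) by (simp add: mult.commute)
  qed
  show ?thesis
  proof (intro bexI[OF _ j(1)] allI impI)
    fix k assume "k \<le> q"
    then obtain A where A: "A \<subseteq> J -` {j} \<inter> {..<L}" "card A = k" "finite A"
      using q obtain_subset_with_card_n by (metis le_trans)
    have "saves r (\<Sum>b<L. if b \<in> A then j * t - 1 else 0) x (x + L * (N * t))"
    proof (rule saves_sum)
      fix b assume b: "b < L"
      have le: "Suc b * (N * t) \<le> L * (N * t)" using b by (intro mult_le_mono1) simp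
      have "saves r 0 (x + b * (N * t)) (x + Suc b * (N * t))"
        by (intro saves_base base_mono[OF bs]) (use le in auto)
      then show "saves r (if b \<in> A then j * t - 1 else 0) (x + b * (N * t)) (x + Suc b * (N * t))"
        using J(2)[OF b] A by auto
    qed
    moreover have "(\<Sum>b<L. if b \<in> A then j * t - 1 else 0) = k * (j * t - 1)"
    proof -
      have "{..<L} \<inter> A = A" using A by auto
      then show ?thesis using A by (simp add: sum.If_cases)
    qed
    ultimately show "saves r (k * (j * t - 1)) x (x + L * (N * t))" by simp
  qed
qed


text \<open>Jumps along step 2 save some fixed \<open>s\<close> each; jumps along step \<open>s\<close> save \<open>-1\<close> modulo \<open>s\<close>, which
  corrects the residue.\<close>

lemma saves_exactly:
  assumes N: "N \<ge> 2" and W: "W = N * E * (N * 2) + 4 * N ^ 3"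
    and bs: "base r x (x + W)" and X: "hits r N {x..x + W}"
    and e: "4 * N ^ 3 \<le> e" "e \<le> E"
  shows "saves r e x (x + W)"
proof -
  let ?y = "x + N * E * (N * 2)"
  \<comment> \<open>Step 2 rather than 1, so that even a jump with \<open>j = 1\<close> saves
    something.\<close>
  have "\<exists>j\<in>{1..<N}. \<forall>k\<le>E. saves r (k * (j * 2 - 1)) x ?y"
    by (rule saves_many_blocks[OF _ N refl base_mono[OF bs] X]) (use W in auto)
  then obtain j where j: "1 \<le> j" "j < N" and many: "\<And>k. k \<le> E \<Longrightarrow> saves r (k * (j * 2 - 1)) x ?y"
    by auto
  define s where "s = j * 2 - 1"
  have s: "1 \<le> s" "s \<le> 2 * N" using j by (auto simp: s_def)
  obtain p where p: "p < s" "s dvd e + p"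
  proof -
    \<comment> \<open>\<open>p\<close> is the residue of \<open>-e\<close> modulo \<open>s\<close>;
      the outer \<open>mod\<close> turns the value \<open>s\<close> into 0.\<close>
    define p where "p = (s - e mod s) mod s"
    have "(e + p) mod s = (e mod s + (s - e mod s)) mod s"
      by (simp add: p_def mod_add_right_eq mod_add_left_eq)
    then have "s dvd e + p" using s by (simp add: mod_eq_0_iff_dvd)
    moreover have "p < s" using s by (simp add: p_def)
    ultimately show ?thesis using that by blast
  qed
  have "p * (N * s) \<le> (2 * N) * (N * (2 * N))"
    using p s by (intro mult_le_mono) auto
  then have pNs: "p * (N * s) \<le> 4 * N ^ 3" by (simp add: power3_eq_cube)
  let ?z = "?y + p * (N * s)"
  have "\<exists>j\<in>{1..<N}. saves r (j * s - 1) (?y + b * (N * s)) (?y + Suc b * (N * s))" if "b < p" for b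
  proof -
    have "Suc b * (N * s) \<le> p * (N * s)" using that by (intro mult_le_mono1) simp
    then have le: "?y + b * (N * s) + N * s \<le> x + W" using pNs W by simp
    have "\<exists>j\<in>{1..<N}. saves r (j * s - 1) (?y + b * (N * s)) (?y + b * (N * s) + N * s)"
    proof (rule saves_block[OF _ _ X])
      show "base r (?y + b * (N * s)) (?y + b * (N * s) + N * s)"
        by (rule base_mono[OF bs _ le]) simp
      fix i assume "i \<le> N"
      then have "i * s \<le> N * s" by simp
      then show "?y + b * (N * s) + i * s \<in> {x..x + W}"
        unfolding atLeastAtMost_iff using le by linarith
    qed (use s in simp)
    then show ?thesis by (simp add: algebra_simps)
  qed
  then obtain J where J: "\<And>b. b < p \<Longrightarrow> J b \<in> {1..<N}"
    "\<And>b. b < p \<Longrightarrow> saves r (J b * s - 1) (?y + b * (N * s)) (?y + Suc b * (N * s))"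
    by metis
  have yz: "saves r (\<Sum>b<p. J b * s - 1) ?y ?z"
    by (rule saves_sum) (use J in blast)
  \<comment> \<open>No subtraction is truncated, since \<open>J b\<close> and \<open>s\<close> are
    positive.\<close>
  have "(\<Sum>b<p. J b * s - 1) + p = (\<Sum>b<p. (J b * s - 1) + 1)"
    by (simp only: sum.distrib) simp
  also have "\<dots> = (\<Sum>b<p. J b * s)"
    by (rule sum.cong) (use J(1) s in \<open>auto simp: Suc_le_eq\<close>)
  finally have sumJ: "(\<Sum>b<p. J b * s - 1) + p = sum J {..<p} * s"
    by (simp add: sum_distrib_right)
  have "sum J {..<p} \<le> p * N"
    using sum_mono[of "{..<p}" J "\<lambda>_. N"] J(1) by fastforce
  \<comment> \<open>The lower bound on \<open>e\<close> enters here: the correcting jumps must not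
    save more than \<open>e\<close>.\<close>
  then have Js: "sum J {..<p} * s \<le> e"
    using mult_le_mono1[of _ "p * N" s] pNs e(1) by (metis le_trans mult.assoc)
  obtain m where m: "e + p = m * s" using p(2) by (metis dvd_def mult.commute)
  define k where "k = m - sum J {..<p}"
  have "sum J {..<p} * s \<le> m * s" using Js m by linarith
  then have Jm: "sum J {..<p} \<le> m" using s by simp
  then have "k * s + sum J {..<p} * s = e + p"
    unfolding m k_def by (simp flip: add_mult_distrib)
  then have ks: "k * s + (\<Sum>b<p. J b * s - 1) = e" using sumJ by linarith
  have "k \<le> k * s" using s by simp
  then have "k \<le> E" using ks e(2) by linarith
  then have "saves r (k * s) x ?y" using many by (simp add: s_def)
  from saves_trans[OF this yz] have "saves r e x ?z" by (simp only: ks)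
  moreover have "saves r 0 ?z (x + W)"
    by (intro saves_base base_mono[OF bs]) (use pNs W in auto)
  ultimately show ?thesis using saves_trans[of r e x ?z 0] by simp
qed

text \<open>However far the end is, fewer than \<open>N\<close> stretches of \<open>g\<close> unit
  steps suffice; everything else is covered by at most \<open>Q\<close> jumps. Otherwise the
  farthest points reachable with \<open>0, ..., N - 1\<close> such stretches would be
  \<open>N\<close> grid points, and a jump between two of them would extend the reach of the earlier
  one.\<close>

lemma short_crossing:
  assumes N: "N > 0" "g > 0" and bs: "base r y (y + Q * g)"
    and X: "hits r N ((\<lambda>i. y + i * g) ` {..Q})"
  shows "\<exists>a<N. \<exists>b\<le>Q. (y, y + Q * g) \<in> r ^^ (a * g + b)"
proof (rule ccontr)
  assume no: "\<not> ?thesis"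
  \<comment> \<open>Every jump advances the grid index, so the number \<open>b\<close> of jumps
    stays at most \<open>i\<close>.\<close>
  define P where "P a i \<longleftrightarrow> i \<le> Q \<and> (\<exists>a'\<le>a. \<exists>b\<le>i. (y, y + i * g) \<in> r ^^ (a' * g + b))" for a i
  have P_mono: "P a' i" if "P a i" "a \<le> a'" for a a' i
    using that le_trans unfolding P_def by blast
  have P_Suc: "P (Suc a) (Suc i)" if "P a i" "i < Q" for a i
  proof -
    from that obtain a' b where ab: "a' \<le> a" "b \<le> i" "(y, y + i * g) \<in> r ^^ (a' * g + b)"
      by (auto simp: P_def)
    have "Suc i * g \<le> Q * g" using that(2) by (intro mult_le_mono1) simp
    then have "(y + i * g, y + i * g + g) \<in> r ^^ g"
      by (intro base_relpow base_mono[OF bs]) auto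
    from relpow_trans[OF ab(3) this] have "(y, y + Suc i * g) \<in> r ^^ (Suc a' * g + b)"
      by (simp add: algebra_simps)
    then show ?thesis unfolding P_def using ab that
      by (intro conjI exI[of _ "Suc a'"] exI[of _ b]) auto
  qed
  have P_jump: "P a i'" if "P a i" "i < i'" "i' \<le> Q" "(y + i * g, y + i' * g) \<in> r" for a i i'
  proof -
    from that obtain a' b where ab: "a' \<le> a" "b \<le> i" "(y, y + i * g) \<in> r ^^ (a' * g + b)"
      by (auto simp: P_def)
    then have "(y, y + i' * g) \<in> r ^^ (a' * g + Suc b)" using that(4) by auto
    then show ?thesis unfolding P_def using ab that
      by (intro conjI exI[of _ a'] exI[of _ "Suc b"]) auto
  qed
  \<comment> \<open>The last grid points reachable with at most \<open>a\<close> grid steps, for \<open>a < N\<close>, are pairwise not joined.\<close>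
  define m where "m a = Max {i. P a i}" for a
  have fin: "finite {i. P a i}" for a
    by (rule finite_subset[of _ "{..Q}"]) (auto simp: P_def)
  have "P a 0" for a unfolding P_def by (auto intro!: exI[of _ 0])
  then have m: "P a (m a)" for a using Max_in[OF fin[of a]] unfolding m_def by blast
  have m_ge: "i \<le> m a" if "P a i" for a i
    using that fin unfolding m_def by simp
  have m_less: "m a < Q" if "a < N" for a
  proof -
    have "m a \<noteq> Q"
    proof
      assume "m a = Q"
      then obtain a' b where "a' \<le> a" "b \<le> Q" "(y, y + Q * g) \<in> r ^^ (a' * g + b)"
        using m[of a] by (auto simp: P_def)
      moreover have "a' < N" using \<open>a' \<le> a\<close> that by simp
      ultimately show False using no by blast
    qed
    then show ?thesis using m[of a] by (simp add: P_def)
  qed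
  have m_strict: "m a < m a'" if "a < a'" "a' < N" for a a'
  proof -
    have "P (Suc a) (Suc (m a))" using P_Suc m m_less that by simp
    then have "P a' (Suc (m a))" using P_mono that by simp
    then show ?thesis using m_ge[of a' "Suc (m a)"] by simp
  qed
  let ?A = "(\<lambda>a. y + m a * g) ` {..<N}"
  have "inj_on (\<lambda>a. y + m a * g) {..<N}"
  proof (rule linorder_inj_onI)
    fix a a' assume "a < a'" "a \<in> {..<N}" "a' \<in> {..<N}"
    then show "y + m a * g \<noteq> y + m a' * g" using m_strict[of a a'] N by auto
  qed auto
  then have "card ?A = card {..<N}" by (rule card_image)
  then have "card ?A = N" by simp
  moreover have "?A \<subseteq> (\<lambda>i. y + i * g) ` {..Q}"
    by (intro image_subsetI imageI) (simp add: m_less less_imp_le)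
  ultimately have "\<exists>u\<in>?A. \<exists>v\<in>?A. u < v \<and> (u, v) \<in> r"
    using X unfolding hits_def by blast
  then obtain a a' where a: "a < N" "a' < N" "m a * g < m a' * g" "(y + m a * g, y + m a' * g) \<in> r"
    by auto
  then have "m a < m a'" by simp
  then have "P a (m a')" using P_jump[OF m[of a] _ _ a(4)] m_less[OF a(2)] by simp
  then show False using m_ge[of a "m a'"] \<open>m a < m a'\<close> by simp
qed

text \<open>The path saves \<open>e\<close> on the first \<open>W\<close> positions and
  \<open>(a + 1) * g - k\<close> by \<open>k\<close> jumps on the grid of step \<open>t\<close>,
  goes straight to \<open>x + u\<close>, and crosses in \<open>a * g + b\<close> steps. As
  \<open>u = h + d' * \<rho> + g\<close> and \<open>e = d' * \<rho> + b + k\<close>, its length is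
  \<open>h\<close>. \<open>F\<close> is the least saving that \<open>saves_exactly\<close> handles
  and \<open>E\<close> bounds \<open>e\<close>. \<open>Z\<close> is a multiple of every possible
  \<open>j\<close> and of \<open>F\<close>. \<open>T\<close> is large enough for the fine grid to
  fit into half of \<open>h\<close>, while \<open>W\<close> fits into the other half.\<close>

lemma exact_shortcut:
  fixes N h d :: nat and x :: nat
  defines "F \<equiv> 4 * N ^ 3" and "T \<equiv> 2 * N ^ 3"
  defines "Z \<equiv> F * fact N"
  defines "E \<equiv> N * (T * Z) + N * T + N * Z"
  defines "W \<equiv> N * E * (N * 2) + F"
  defines "t \<equiv> h div (T * Z)"
  assumes h: "h \<ge> 2 * W" "h \<ge> T * Z" and d: "2 \<le> d" "d < N"
    and bs: "base r x (x + d * h)" and X: "hits r N X"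
    and X1: "{x..x + W} \<subseteq> X"
    and X2: "\<And>i. i \<le> N * (N * Z) * N \<Longrightarrow> W + i * t \<le> d * h \<Longrightarrow> x + W + i * t \<in> X"
    and X3: "\<And>i. i \<le> N * T \<Longrightarrow> i * (Z * t) \<le> d * h \<Longrightarrow> x + d * h - i * (Z * t) \<in> X"
  shows "(x, x + d * h) \<in> r ^^ h"
proof -
  define g where "g = Z * t"
  define \<rho> where "\<rho> = h mod (T * Z)"
  define d' where "d' = d - 1"
  \<comment> \<open>One step fewer than \<open>d' * T\<close>: the extra \<open>g\<close> in
    \<open>u\<close> leaves something to save even if \<open>a = 0\<close>, which keeps
    \<open>k\<close>, and so \<open>e\<close>, at least \<open>F\<close>.\<close>
  define Q where "Q = d' * T - 1"
  have N: "N \<ge> 2" using d by simp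
  have "F > 0" "T > 0" using N by (auto simp: F_def T_def)
  then have Z: "Z > 0" by (simp add: Z_def)
  have t: "t > 0" using h(2) Z \<open>T > 0\<close> by (simp add: t_def div_greater_zero_iff)
  have g: "g > 0" using Z t by (simp add: g_def)
  have hg: "h = T * g + \<rho>"
    using div_mult_mod_eq[of h "T * Z"] by (simp add: t_def g_def \<rho>_def algebra_simps)
  have \<rho>: "\<rho> \<le> T * Z" using Z \<open>T > 0\<close> by (simp add: \<rho>_def less_imp_le)
  have d': "d = Suc d'" "d' \<ge> 1" "d' < N" using d by (auto simp: d'_def)
  have Q: "Suc Q = d' * T" using d' \<open>T > 0\<close> by (simp add: Q_def)
  define u where "u = h + d' * \<rho> + g"
  have dh: "d * h = u + Q * g"
  proof -
    have "d * h = h + d' * (T * g + \<rho>)" using d' hg by simp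
    also have "\<dots> = h + d' * \<rho> + Suc Q * g" unfolding Q by (simp add: algebra_simps)
    finally show ?thesis by (simp add: u_def)
  qed
  have "d' * T \<le> N * T" using d' by (intro mult_le_mono1) simp
  then have QT: "Q \<le> N * T" using Q by linarith
  have "\<exists>a<N. \<exists>b\<le>Q. (x + u, x + u + Q * g) \<in> r ^^ (a * g + b)"
  proof (rule short_crossing[OF _ g])
    show "base r (x + u) (x + u + Q * g)" by (rule base_mono[OF bs]) (use dh in auto)
    show "hits r N ((\<lambda>i. x + u + i * g) ` {..Q})"
    proof (rule hits_mono[OF X], intro image_subsetI)
      fix i assume "i \<in> {..Q}"
      \<comment> \<open>The coarse grid in \<open>X\<close> is measured back from the end point, so
        the index is reversed.\<close>
      then obtain i' where i': "Q = i + i'" by (auto simp: le_iff_add)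
      then have "x + d * h - i' * g \<in> X"
        unfolding g_def using QT dh by (intro X3) (auto simp: g_def algebra_simps)
      moreover have "x + d * h - i' * g = x + u + i * g" using dh i' by (simp add: algebra_simps)
      ultimately show "x + u + i * g \<in> X" by simp
    qed
  qed (use N in simp)
  then obtain a b where ab: "a < N" "b \<le> Q" "(x + u, x + d * h) \<in> r ^^ (a * g + b)"
    using dh by (auto simp: add.assoc)
  let ?L = "N * (N * Z)"
  have "2 * (?L * (N * t)) = T * g" by (simp add: T_def g_def power3_eq_cube)
  then have L: "W + ?L * (N * t) \<le> h" using h(1) hg by linarith
  have hu: "h \<le> u" and ud: "u \<le> d * h" using dh by (auto simp: u_def)
  let ?z = "x + W + ?L * (N * t)"
  have "\<exists>j\<in>{1..<N}. \<forall>k\<le>N * Z. saves r (k * (j * t - 1)) (x + W) ?z"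
  proof (rule saves_many_blocks[OF t N refl base_mono[OF bs] X])
    fix i assume i: "i \<le> ?L * N"
    then have "i * t \<le> ?L * N * t" by (rule mult_le_mono1)
    then have "i * t \<le> ?L * (N * t)" by (simp only: mult.assoc)
    then show "x + W + i * t \<in> X" using L hu ud i by (intro X2) linarith+
  qed (use L hu ud in auto)
  then obtain j where j: "1 \<le> j" "j < N"
    and many: "\<And>k. k \<le> N * Z \<Longrightarrow> saves r (k * (j * t - 1)) (x + W) ?z" by auto
  obtain f where f: "fact N = j * f"
    using j dvd_fact[of j N] by (auto simp: dvd_def)
  then have "f > 0" by (intro gr0I) simp
  \<comment> \<open>Chosen so that \<open>k * j * t = (a + 1) * g\<close>: the \<open>k\<close>
    jumps save this amount up to the bounded error \<open>k\<close>, one per jump.\<close>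
  define k where "k = Suc a * (F * f)"
  have kj: "k * j = Suc a * Z" by (simp add: k_def Z_def f algebra_simps)
  have "F * f \<le> k" by (simp add: k_def)
  moreover have "F \<le> F * f" using \<open>f > 0\<close> by simp
  ultimately have kF: "F \<le> k" by linarith
  have "k \<le> k * j" using j by simp
  also have "\<dots> \<le> N * Z" unfolding kj using ab by (intro mult_le_mono1) simp
  finally have kZ: "k \<le> N * Z" .
  have "k * (j * t - 1) + k = k * (j * t)"
    using j t by (cases "j * t") auto
  also have "\<dots> = Suc a * g" by (simp only: kj g_def flip: mult.assoc)
  finally have kg: "k * (j * t - 1) + k = Suc a * g" .
  define e where "e = d' * \<rho> + b + k"
  have "d' * \<rho> \<le> N * (T * Z)" using d' \<rho> by (intro mult_le_mono) auto
  then have "e \<le> E" unfolding e_def E_def using ab(2) QT kZ by linarith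
  moreover have "4 * N ^ 3 \<le> e" using kF by (simp add: e_def F_def)
  moreover have "base r x (x + W)" by (rule base_mono[OF bs]) (use L hu ud in auto)
  moreover have "hits r N {x..x + W}" using X X1 by (rule hits_mono)
  ultimately have "saves r e x (x + W)"
    using N by (intro saves_exactly[where E = E and N = N]) (auto simp: W_def F_def)
  moreover have "saves r 0 ?z (x + u)"
    by (intro saves_base base_mono[OF bs]) (use L hu ud in auto)
  ultimately have "saves r (e + k * (j * t - 1) + 0) x (x + u)"
    by (intro saves_trans[OF saves_trans[OF _ many[OF kZ]]])
  then obtain l where l: "(x, x + u) \<in> r ^^ l" "l + (e + k * (j * t - 1)) = u"
    by (auto simp: saves_def)
  then have "l + (a * g + b) = h" using kg unfolding e_def u_def by simp
  then show ?thesis using relpow_trans[OF l(1) ab(3)] by simp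
qed

text \<open>A joined pair among \<open>0, h, ..., (N - 1) * h\<close> is the chord that closes the
  cycle. It is known only after Painter's answers, so \<open>S\<close> serves all starting points
  \<open>i * h\<close> and all distances \<open>d * h\<close> at once; its size is still bounded
  independently of \<open>h\<close>.\<close>

lemma exact_chord:
  assumes N: "N \<ge> 2"
  shows "\<exists>n0 c. \<forall>h\<ge>n0. \<exists>S. finite S \<and> card S \<le> c \<and> S \<subseteq> {..(N - 1) * h} \<and>
    (\<forall>r. base r 0 ((N - 1) * h) \<longrightarrow> hits r N S \<longrightarrow> (\<exists>x y. (x, y) \<in> r \<and> (x, y) \<in> r ^^ h))"
proof -
  define F where "F = 4 * N ^ 3"
  define T where "T = 2 * N ^ 3"
  define Z where "Z = F * fact N"
  define E where "E = N * (T * Z) + N * T + N * Z"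
  define W where "W = N * E * (N * 2) + F"
  define c where "c = N * (Suc W + Suc (N * (N * Z) * N) + Suc N * Suc (N * T))"
  define n0 where "n0 = Suc (2 * W + T * Z)"
  have "\<exists>S. finite S \<and> card S \<le> c \<and> S \<subseteq> {..(N - 1) * h} \<and>
    (\<forall>r. base r 0 ((N - 1) * h) \<longrightarrow> hits r N S \<longrightarrow> (\<exists>x y. (x, y) \<in> r \<and> (x, y) \<in> r ^^ h))"
    if "n0 \<le> h" for h
  proof -
    have h: "2 * W \<le> h" "T * Z \<le> h" "h > 0" using that by (auto simp: n0_def)
    define t where "t = h div (T * Z)"
    \<comment> \<open>\<open>S1\<close> is the fine grid, and \<open>S2\<close> the coarse grids
      counted back from each possible end point. Values of \<open>S2\<close> truncated to 0 are
      harmless.\<close>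
    define S1 where "S1 = (\<lambda>i. W + i * t) ` {..N * (N * Z) * N}"
    define S2 where "S2 = (\<lambda>(d, i). d * h - i * (Z * t)) ` ({..N} \<times> {..N * T})"
    define S0 where "S0 = {..W} \<union> S1 \<union> S2"
    define S where "S = (\<Union>i<N. (\<lambda>x. i * h + x) ` S0) \<inter> {..(N - 1) * h}"
    have fin: "finite S0" by (simp add: S0_def S1_def S2_def)
    have "card S1 \<le> Suc (N * (N * Z) * N)" "card S2 \<le> Suc N * Suc (N * T)"
      unfolding S1_def S2_def
      by (rule order_trans[OF card_image_le], simp, simp add: card_cartesian_product)+
    then have S0: "card S0 \<le> Suc W + Suc (N * (N * Z) * N) + Suc N * Suc (N * T)"
      unfolding S0_def using card_Un_le[of "{..W}" S1] card_Un_le[of "{..W} \<union> S1" S2]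
      by (simp only: card_atMost)
    have "card S \<le> card (\<Union>i<N. (\<lambda>x. i * h + x) ` S0)"
      unfolding S_def by (rule card_mono) (use fin in auto)
    also have "\<dots> \<le> (\<Sum>i<N. card ((\<lambda>x. i * h + x) ` S0))"
      by (rule card_UN_le) simp
    also have "\<dots> \<le> (\<Sum>i<N. card S0)"
      by (rule sum_mono) (simp add: card_image_le fin)
    also have "\<dots> \<le> c" unfolding c_def using S0 by (simp only: sum_constant card_lessThan of_nat_id mult_le_mono2)
    finally have cS: "card S \<le> c" .
    have S_I: "i * h + s \<in> S" if "i < N" "s \<in> S0" "i * h + s \<le> (N - 1) * h" for i s
      using that unfolding S_def by blast
    have "\<exists>x y. (x, y) \<in> r \<and> (x, y) \<in> r ^^ h"
      if bs: "base r 0 ((N - 1) * h)" and X: "hits r N S" for r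
    proof -
      let ?A = "(\<lambda>i. i * h) ` {..<N}"
      have "card ?A = N" using h by (subst card_image) (auto simp: inj_on_def)
      moreover have "?A \<subseteq> S"
      proof (intro image_subsetI)
        fix i assume "i \<in> {..<N}"
        then have "i < N" "i * h \<le> (N - 1) * h" by (auto intro: mult_le_mono1)
        then show "i * h \<in> S" using S_I[of i 0] by (simp add: S0_def)
      qed
      ultimately have "\<exists>u\<in>?A. \<exists>v\<in>?A. u < v \<and> (u, v) \<in> r"
        using X unfolding hits_def by blast
      then obtain i i' where i: "i' < N" "i < i'" "(i * h, i' * h) \<in> r"
        by auto
      then obtain d where d: "i' = i + d" "d > 0" using less_imp_add_positive by blast
      have i'h: "i' * h = i * h + d * h" using d by (simp add: add_mult_distrib)
      have i'N: "i' * h \<le> (N - 1) * h" using i by (intro mult_le_mono1) simp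
      have bs': "base r (i * h) (i * h + d * h)"
        by (rule base_mono[OF bs]) (use i'h i'N in auto)
      have "(i * h, i' * h) \<in> r ^^ h"
      \<comment> \<open>For \<open>d = 1\<close> the base path between the two ends already has
        length \<open>h\<close>.\<close>
      proof (cases "d = 1")
        case True
        then show ?thesis using base_relpow[of r "i * h" h] bs' i'h by simp
      next
        case False
        have hd: "h \<le> d * h" using d by simp
        have in_S: "i * h + s \<in> S" if "s \<in> S0" "s \<le> d * h" for s
          using that i i'h i'N by (intro S_I) auto
        have "(i * h, i * h + d * h) \<in> r ^^ h"
        proof (rule exact_shortcut[OF h(1,2)[unfolded W_def E_def Z_def T_def F_def] _ _ bs' X],
            fold F_def T_def, fold Z_def, fold E_def, fold W_def t_def)
          show "{i * h..i * h + W} \<subseteq> S"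
          proof
            fix z assume z: "z \<in> {i * h..i * h + W}"
            have "W \<le> d * h" using h(1) hd by linarith
            moreover have "z - i * h \<le> W" using z by auto
            ultimately have "i * h + (z - i * h) \<in> S"
              by (intro in_S) (simp add: S0_def, linarith)
            then show "z \<in> S" using z by simp
          qed
          show "i * h + W + k * t \<in> S" if "k \<le> N * (N * Z) * N" "W + k * t \<le> d * h" for k
            using that in_S[of "W + k * t"] by (auto simp: S0_def S1_def add.assoc)
          show "i * h + d * h - k * (Z * t) \<in> S" if "k \<le> N * T" "k * (Z * t) \<le> d * h" for k
          proof -
            have "d * h - k * (Z * t) \<in> S2" unfolding S2_def
              by (rule image_eqI[of _ _ "(d, k)"]) (use that d i in auto)
            then show ?thesis using that in_S[of "d * h - k * (Z * t)"] by (auto simp: S0_def)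
          qed
        qed (use d i False in auto)
        then show ?thesis by (simp add: i'h)
      qed
      then show ?thesis using i by blast
    qed
    moreover have "finite S" "S \<subseteq> {..(N - 1) * h}" using fin by (auto simp: S_def)
    ultimately show ?thesis using cS by blast
  qed
  then show ?thesis by blast
qed

section \<open>From blue paths to blue cycles\<close>

lemma has_copy_pathD:
  assumes "has_copy (ordered_path (Suc M)) \<lparr>verts = UNIV, edges = E\<rparr>"
  obtains v :: "nat \<Rightarrow> 'b::linorder"
    where "strict_mono_on {..M} v" "\<And>i. i < M \<Longrightarrow> {v i, v (Suc i)} \<in> E"
proof -
  obtain H f where H: "subgraph H \<lparr>verts = UNIV, edges = E\<rparr>"
    and f: "order_iso f (ordered_path (Suc M)) H"
    using assms unfolding has_copy_def by blast
  have mono: "strict_mono_on {1..Suc M} f"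
    and edges: "(\<lambda>e. f ` e) ` edges (ordered_path (Suc M)) \<subseteq> E"
    using H f by (auto simp: subgraph_def order_iso_def ordered_path_def)
  show ?thesis
  proof (rule that)
    show "strict_mono_on {..M} (\<lambda>i. f (Suc i))"
      using mono by (auto simp: strict_mono_on_def)
    fix i assume "i < M"
    then have "{Suc i, Suc i + 1} \<in> edges (ordered_path (Suc M))"
      unfolding ordered_path_def by force
    then have "f ` {Suc i, Suc i + 1} \<in> E" using edges by blast
    then show "{f (Suc i), f (Suc (Suc i))} \<in> E" by simp
  qed
qed

lemma has_copy_cycleI:
  fixes w :: "nat \<Rightarrow> 'b::linorder"
  assumes "strict_mono_on {..h} w" "\<And>i. i < h \<Longrightarrow> {w i, w (Suc i)} \<in> E" "{w 0, w h} \<in> E"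
  shows "has_copy (ordered_cycle (Suc h)) \<lparr>verts = UNIV, edges = E\<rparr>"
proof (rule has_copyI[where f = "\<lambda>i. w (i - 1)"])
  show "strict_mono_on (verts (ordered_cycle (Suc h))) (\<lambda>i. w (i - 1))"
  proof (rule strict_mono_onI)
    fix i j assume "i \<in> verts (ordered_cycle (Suc h))" "j \<in> verts (ordered_cycle (Suc h))" "i < j"
    then show "w (i - 1) < w (j - 1)"
      by (intro strict_mono_onD[OF assms(1)]) (auto simp: ordered_cycle_def)
  qed
  show "\<forall>e\<in>edges (ordered_cycle (Suc h)). e \<subseteq> verts (ordered_cycle (Suc h)) \<and> (\<lambda>i. w (i - 1)) ` e \<in> E"
  proof
    fix e assume "e \<in> edges (ordered_cycle (Suc h))"
    then consider i where "e = {i, i + 1}" "1 \<le> i" "i < Suc h" | "e = {1, Suc h}"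
      by (auto simp: ordered_cycle_def ordered_path_def split: if_splits)
    then show "e \<subseteq> verts (ordered_cycle (Suc h)) \<and> (\<lambda>i. w (i - 1)) ` e \<in> E"
    proof cases
      case 1
      then show ?thesis using assms(2)[of "i - 1"] by (auto simp: ordered_cycle_def)
    next
      case 2
      then show ?thesis using assms(3) by (auto simp: ordered_cycle_def)
    qed
  qed
qed

lemma strict_mono_on_Suc:
  fixes f :: "nat \<Rightarrow> 'b::order"
  assumes "\<And>i. i < h \<Longrightarrow> f i < f (Suc i)"
  shows "strict_mono_on {..h} f"
proof -
  have "i < j \<Longrightarrow> j \<le> h \<Longrightarrow> f i < f j" for i j
  proof (induction j)
    case (Suc j)
    then have "f j < f (Suc j)" using assms by simp
    then show ?case using Suc by (cases "i = j") (auto intro: less_trans)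
  qed simp
  then show ?thesis by (auto simp: strict_mono_on_def)
qed

lemma builder_forces_cycle:
  fixes G :: "'a::linorder ograph" and v :: "nat \<Rightarrow> nat"
  assumes G: "ordered_graph G" and h: "h > 0"
    and v: "strict_mono_on {..M} v" "\<And>i. i < M \<Longrightarrow> {v i, v (Suc i)} \<in> B"
    and S: "finite S" "S \<subseteq> {..M}"
    and chord: "\<And>r. base r 0 M \<Longrightarrow> hits r (card (verts G)) S \<Longrightarrow>
      \<exists>x y. (x, y) \<in> r \<and> (x, y) \<in> r ^^ h"
  shows "builder_forces G (ordered_cycle (Suc h)) (card S choose 2) R B"
proof -
  have inj: "inj_on v {..M}" using v(1) by (rule strict_mono_on_imp_inj_on)
  have "card S choose 2 = card (pairs (v ` S))"
    using S inj by (simp add: card_pairs card_image inj_on_subset)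
  also have "builder_forces G (ordered_cycle (Suc h)) \<dots> R B"
  proof (rule builder_forces_query)
    fix R' B' assume B': "B \<subseteq> B'" and RB': "pairs (v ` S) \<subseteq> R' \<union> B'"
    \<comment> \<open>Working with positions \<open>i < j\<close> makes every \<open>r\<close>-walk
      increasing, so its vertices come in the order of the cycle.\<close>
    define r where "r = {(i, j). i < j \<and> j \<le> M \<and> {v i, v j} \<in> B'}"
    show "game_over G (ordered_cycle (Suc h)) R' B'"
    proof (cases "hits r (card (verts G)) S")
      case True
      moreover have "base r 0 M" using v(2) B' by (auto simp: base_def r_def)
      ultimately obtain x y where xy: "(x, y) \<in> r" "(x, y) \<in> r ^^ h" using chord by blast
      then obtain p where p: "p 0 = x" "p h = y" "\<And>i. i < h \<Longrightarrow> (p i, p (Suc i)) \<in> r"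
        unfolding relpow_fun_conv by blast
      have p_mono: "strict_mono_on {..h} p"
        by (rule strict_mono_on_Suc) (use p(3) in \<open>auto simp: r_def\<close>)
      have "p i \<le> M" if "i \<le> h" for i
        using strict_mono_on_leD[OF p_mono, of i h] that p(2) xy(1) by (auto simp: r_def)
      then have "strict_mono_on {..h} (\<lambda>i. v (p i))"
        using p_mono v(1) by (auto simp: strict_mono_on_def)
      then have "has_copy (ordered_cycle (Suc h)) \<lparr>verts = UNIV, edges = B'\<rparr>"
        by (rule has_copy_cycleI) (use p xy(1) in \<open>auto simp: r_def\<close>)
      then show ?thesis by (simp add: game_over_def)
    next
      case False
      then obtain A where A: "A \<subseteq> S" "card A = card (verts G)"
        "\<And>a b. a \<in> A \<Longrightarrow> b \<in> A \<Longrightarrow> a < b \<Longrightarrow> (a, b) \<notin> r"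
        unfolding hits_def by blast
      have red: "{v a, v b} \<in> R'" if "a \<in> A" "b \<in> A" "a < b" for a b
      proof -
        have ab: "a \<in> S" "b \<in> S" "a \<le> M" "b \<le> M" using that A(1) S(2) by auto
        then have "v a \<noteq> v b" using inj that(3) by (auto dest: inj_onD)
        then have "{v a, v b} \<in> pairs (v ` S)" using ab by (simp add: pairs_def)
        then show ?thesis using RB' A(3)[OF that] that(3) ab by (auto simp: r_def)
      qed
      have "clique (v ` A) R'"
        unfolding clique_def
      proof (intro ballI impI)
        fix s s' assume "s \<in> v ` A" "s' \<in> v ` A" "s \<noteq> s'"
        then obtain a b where ab: "a \<in> A" "b \<in> A" "s = v a" "s' = v b" "a \<noteq> b" by blast
        then show "{s, s'} \<in> R'"
          using red[of a b] red[of b a] by (cases a b rule: linorder_cases) (auto simp: insert_commute)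
      qed
      moreover have "inj_on v A" using inj A(1) S(2) by (rule inj_on_subset[OF _ order_trans])
      ultimately have "has_copy G \<lparr>verts = UNIV, edges = R'\<rparr>"
        using A(2) finite_subset[OF A(1) S(1)]
        by (intro has_copy_clique[OF G, of "v ` A"]) (auto simp: card_image)
      then show ?thesis by (simp add: game_over_def)
    qed
  qed (use S in \<open>auto simp: finite_pairs\<close>, auto simp: pairs_def)
  finally show ?thesis .
qed

theorem theorem1p8:
  fixes G :: "'a::linorder ograph"
  assumes "ordered_graph G"
  shows "\<exists>c::nat. \<forall>n\<ge>1.
    r_o G (ordered_cycle n) \<le> r_o G (ordered_path ((n - 1) * (card (verts G) - 1) + 1)) + enat c"
proof (cases "card (verts G) \<ge> 2")
  case False
  \<comment> \<open>With at most one vertex, \<open>G\<close> has a copy before any edge is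
    drawn.\<close>
  then have "clique {..<card (verts G)} {}" by (auto simp: clique_def)
  then have "has_copy G \<lparr>verts = UNIV, edges = {} :: nat set set\<rparr>"
    by (intro has_copy_clique[OF assms, of "{..<card (verts G)}"]) auto
  then have "builder_forces G (ordered_cycle n) 0 {} {}" for n
    by (simp add: game_over_def)
  then have "r_o G (ordered_cycle n) \<le> 0" for n
    unfolding zero_enat_def by (rule r_o_le)
  then show ?thesis by (intro exI[of _ 0] allI impI) (rule order_trans[OF _ zero_le])
next
  case True
  let ?N = "card (verts G)"
  obtain n0 c where chord: "\<And>h. h \<ge> n0 \<Longrightarrow> \<exists>S. finite S \<and> card S \<le> c \<and> S \<subseteq> {..(?N - 1) * h} \<and>
    (\<forall>r. base r 0 ((?N - 1) * h) \<longrightarrow> hits r ?N S \<longrightarrow> (\<exists>x y. (x, y) \<in> r \<and> (x, y) \<in> r ^^ h))"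
    using exact_chord[OF True] by blast
  obtain K where K: "\<And>n. builder_forces G (ordered_cycle n) (K n) {} {}"
    using builder_forces_ramsey[OF assms ordered_graph_cycle] by metis
  \<comment> \<open>The sum pays for the finitely many small cycles, the binomial for the edges
    inside \<open>S\<close>.\<close>
  define C where "C = (\<Sum>n\<le>Suc n0. K n) + (c choose 2)"
  show ?thesis
  proof (intro exI[of _ C] allI impI)
    fix n :: nat assume "n \<ge> 1"
    define h where "h = n - 1"
    let ?P = "ordered_path ((n - 1) * (card (verts G) - 1) + 1)"
    have n: "n = Suc h" using \<open>n \<ge> 1\<close> by (simp add: h_def)
    have P: "?P = ordered_path (Suc ((?N - 1) * h))" by (simp add: n mult.commute)
    show "r_o G (ordered_cycle n) \<le> r_o G ?P + enat C"
    proof (cases "n \<le> Suc n0")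
      case True
      then have "K n \<le> (\<Sum>n\<le>Suc n0. K n)" by (intro member_le_sum) auto
      then have "enat (K n) \<le> enat C" by (simp add: C_def)
      then have "r_o G (ordered_cycle n) \<le> enat C" using r_o_le[OF K] by (rule order_trans[rotated])
      then show ?thesis by (simp add: add_increasing)
    next
      case False
      then have h: "h \<ge> n0" "h > 0" using n by auto
      show ?thesis
      \<comment> \<open>An infinite value makes the bound trivial.\<close>
      proof (cases "r_o G ?P")
        case (enat k)
        have "builder_forces G (ordered_cycle n) (k + C) {} {}"
        proof (rule builder_forces_trans[OF r_o_enat_imp_builder_forces[OF enat]])
          fix R B :: "nat set set"
          assume "game_over G ?P R B"
          then consider "has_copy G \<lparr>verts = UNIV, edges = R\<rparr>"
            | "has_copy (ordered_path (Suc ((?N - 1) * h))) \<lparr>verts = UNIV, edges = B\<rparr>"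
            unfolding P game_over_def by blast
          then show "builder_forces G (ordered_cycle n) C R B"
          proof cases
            case 1
            then show ?thesis by (intro game_over_imp_builder_forces) (simp add: game_over_def)
          next
            case 2
            from has_copy_pathD[OF 2] obtain v where v: "strict_mono_on {..(?N - 1) * h} v"
              "\<And>i. i < (?N - 1) * h \<Longrightarrow> {v i, v (Suc i)} \<in> B"
              by blast
            obtain S where S: "finite S" "card S \<le> c" "S \<subseteq> {..(?N - 1) * h}"
              and ch: "\<And>r. base r 0 ((?N - 1) * h) \<Longrightarrow> hits r ?N S \<Longrightarrow>
                \<exists>x y. (x, y) \<in> r \<and> (x, y) \<in> r ^^ h"
              using chord[OF h(1)] by blast
            have "builder_forces G (ordered_cycle n) (card S choose 2) R B"
              unfolding n by (rule builder_forces_cycle[OF assms h(2) v S(1,3) ch])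
            moreover have "card S choose 2 \<le> C"
              using binomial_right_mono[OF S(2), of 2] by (simp add: C_def)
            ultimately show ?thesis by (rule builder_forces_mono)
          qed
        qed
        then have "r_o G (ordered_cycle n) \<le> enat (k + C)" by (rule r_o_le)
        then show ?thesis unfolding enat by simp
      qed simp
    qed
  qed
qed

end
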